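(* For every integer $n>8$ there are at least eighteen prime numbers $p$ with $n<p<9n$. *)

theory Defs
  imports "HOL-Computational_Algebra.Primes"
begin

end

theory Submission
  imports Defs "HOL-Library.Discrete_Functions"
begin

text \<open>
  Let \<open>L\<close> be the least common multiple of \<open>1, \<dots>, 8n + 1\<close>. The entries of the Leibniz harmonic triangle
  show that \<open>(8n + 1) * binomial (8n) (4n)\<close> divides \<open>L\<close>, so \<open>L \<ge> 4 ^ (4n)\<close>. On the other
  hand every prime power in \<open>L\<close> is at most \<open>8n + 1\<close>, and a prime above \<open>sqrt (8n + 1)\<close> occurs
  only to the first power, so the primes up to \<open>n\<close> contribute at most
  \<open>4 ^ n * (8n + 1) ^ sqrt (8n + 1)\<close>. Hence with at most 17 primes between \<open>n\<close> and \<open>8n + 1\<close> we would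
  get \<open>4 ^ (3n) \<le> (8n + 1) ^ (17 + sqrt (8n + 1))\<close>, which fails for \<open>n \<ge> 256\<close>. Smaller \<open>n\<close> are
  covered by four explicit lists of 18 primes.
\<close>

section \<open>Lower bound for the lcm from the Leibniz triangle\<close>

lemma Suc_times_binomial_dvd:
  fixes L :: nat
  assumes "\<And>i. 1 \<le> i \<Longrightarrow> i \<le> Suc n \<Longrightarrow> i dvd L" and "k \<le> n"
  shows "Suc n * (n choose k) dvd L"
  using assms
proof (induction k arbitrary: n)
  case 0
  then show ?case by simp
next
  case (Suc k)
  then obtain m where n: "n = Suc m" and km: "k \<le> m"
    by (cases n) auto
  define a where "a = Suc n * (n choose Suc k)"
  define b where "b = Suc n * (n choose k)"
  define c where "c = Suc m * (m choose k)"
  \<comment> \<open>The three relations together say \<open>1 / a = 1 / c - 1 / b\<close>, the Leibniz triangle recurrence.\<close>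
  have a: "Suc k * a = Suc n * c"
    unfolding a_def c_def n using Suc_times_binomial[of k m] by (metis mult.left_commute)
  have b: "(Suc m - k) * b = Suc n * c"
    unfolding b_def c_def n using binomial_absorb_comp[of "Suc m" k]
    by (metis diff_Suc_1 mult.left_commute)
  have "b dvd L" "c dvd L"
    using Suc.IH[of n] Suc.IH[of m] Suc.prems km by (auto simp: b_def c_def n)
  then obtain x y where x: "L = c * x" and y: "L = b * y"
    by (auto simp: dvd_def)
  \<comment> \<open>Over \<open>int\<close> the difference \<open>x - y\<close> is not truncated; it
    is L/c - L/b, which the recurrence identifies with L/a.\<close>
  have a': "(int k + 1) * int a = (int m + 2) * int c"
    using arg_cong[OF a, of int] by (simp add: n algebra_simps)
  have b': "(int m + 1 - int k) * int b = (int m + 2) * int c"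
    using arg_cong[OF b, of int] km by (simp only: of_nat_mult of_nat_diff n) (simp add: add.commute)
  have x': "int L = int c * int x" and y': "int L = int b * int y"
    using x y by (simp_all flip: of_nat_mult)
  have "(int k + 1) * (int a * (int x - int y)) = (int m + 2) * int c * (int x - int y)"
    using a' by (simp flip: mult.assoc)
  also have "\<dots> = (int m + 2) * int L - (int m + 1 - int k) * int b * int y"
    unfolding b' x' by (simp add: algebra_simps)
  also have "\<dots> = (int k + 1) * int L"
    using y' by (simp add: algebra_simps)
  finally have "int L = int a * (int x - int y)"
    by simp
  then have "a dvd L"
    by (metis dvd_triv_left int_dvd_int_iff)
  then show ?case by (simp only: a_def)
qed

text \<open>Row \<open>2 * m\<close> of Pascal's triangle has \<open>2 * m + 1\<close> entries with
  sum \<open>4 ^ m\<close>, none above the central one.\<close>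

lemma four_power_le_Lcm: "4 ^ m \<le> Lcm {1..Suc (2 * m)}"
proof -
  have pos: "Lcm {1..Suc (2 * m)} > 0"
    by (simp only: Lcm_0_iff neq0_conv[symmetric]) simp
  have "(2::nat) ^ (2 * m) = (\<Sum>k\<le>2 * m. 2 * m choose k)"
    by (simp add: choose_row_sum)
  also have "\<dots> \<le> (\<Sum>k\<le>2 * m. 2 * m choose m)"
    by (intro sum_mono binomial_maximum')
  finally have "4 ^ m \<le> Suc (2 * m) * (2 * m choose m)"
    by (simp add: power_mult)
  also have "\<dots> \<le> Lcm {1..Suc (2 * m)}"
    by (rule dvd_imp_le[OF Suc_times_binomial_dvd pos]) auto
  finally show ?thesis .
qed

text \<open>The multiplicity of \<open>p\<close> in an lcm of nonzero numbers is the maximum of the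
  multiplicities, so some element attains it. If 0 occurs in \<open>A\<close>, it is itself a
  witness; \<open>e = 0\<close> covers the empty set.\<close>

lemma prime_power_dvd_Lcm:
  fixes p :: nat
  assumes "finite A" "prime p" "p ^ e dvd Lcm A"
  shows "e = 0 \<or> (\<exists>x\<in>A. p ^ e dvd x)"
  using assms(1,3)
proof (induction A)
  case empty
  then show ?case using assms(2) by (auto dest: not_prime_unit)
next
  case (insert x A)
  show ?case
  proof (cases "x = 0 \<or> Lcm A = 0")
    case True
    then show ?thesis using insert by (auto simp: Lcm_0_iff)
  next
    case False
    have "e \<le> multiplicity p (lcm x (Lcm A))"
      using insert.prems assms(2) False
      by (intro multiplicity_geI) (auto simp: lcm_eq_0_iff dest: not_prime_unit)
    also have "\<dots> = max (multiplicity p x) (multiplicity p (Lcm A))"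
      using False assms(2) by (intro multiplicity_lcm) auto
    finally show ?thesis
      using insert.IH by (auto simp: le_max_iff_disj intro: multiplicity_dvd')
  qed
qed

lemma prime_power_multiplicity_Lcm_le:
  fixes p N :: nat
  assumes "prime p" "N > 0"
  shows "p ^ multiplicity p (Lcm {1..N}) \<le> N"
  using prime_power_dvd_Lcm[OF _ assms(1) multiplicity_dvd, of "{1..N}"] assms(2)
  by (force dest: dvd_imp_le)

section \<open>Chebyshev-type bound for the product of primes\<close>

lemma prod_primes_dvd:
  fixes m :: nat
  assumes "finite A" "\<And>p. p \<in> A \<Longrightarrow> prime p \<and> p dvd m"
  shows "\<Prod>A dvd m"
  using assms
proof (induction A)
  case (insert p A)
  have "coprime p (\<Prod>A)"
    using insert by (intro prod_coprime_right) (metis insertCI primes_coprime)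
  then show ?case using insert by (simp add: divides_mult)
qed simp

text \<open>The two middle entries of row \<open>2 * m + 1\<close> are equal, and the whole row sums
  to \<open>2 * 4 ^ m\<close>.\<close>

lemma binomial_odd_le_four_power: "Suc (2 * m) choose m \<le> 4 ^ m"
proof -
  have "2 * (Suc (2 * m) choose m) = (\<Sum>k\<in>{m, Suc m}. Suc (2 * m) choose k)"
    using binomial_symmetric[of m "Suc (2 * m)"] by (simp add: Suc_diff_le)
  also have "\<dots> \<le> (\<Sum>k\<le>Suc (2 * m). Suc (2 * m) choose k)"
    by (intro sum_mono2) auto
  also have "\<dots> = 2 * 4 ^ m"
    by (simp only: choose_row_sum) (simp add: power_mult)
  finally show ?thesis by simp
qed

text \<open>The prime divides \<open>fact n\<close> but neither factorial in the
  denominator.\<close>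

lemma prime_dvd_binomial:
  fixes p n k :: nat
  assumes "prime p" "k < p" "n - k < p" "p \<le> n"
  shows "p dvd n choose k"
proof -
  have "fact k * fact (n - k) * (n choose k) = (fact n :: nat)"
    using assms by (intro binomial_fact_lemma) auto
  then have "p dvd fact k * fact (n - k) * (n choose k)"
    using assms by (simp add: prime_dvd_fact_iff)
  then show ?thesis
    using assms by (simp add: prime_dvd_mult_iff prime_dvd_fact_iff)
qed

text \<open>Erdos's induction: an even \<open>n > 2\<close> is not prime and reduces to
  \<open>n - 1\<close>; for \<open>n = 2 * m + 1\<close> the primes above \<open>m + 1\<close> all
  divide \<open>n choose m\<close>, which is at most \<open>4 ^ m\<close>.\<close>

lemma prod_primes_le_four_power: "\<Prod>{p::nat. prime p \<and> p \<le> n} \<le> 4 ^ n"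
proof (induction n rule: less_induct)
  case (less n)
  consider "n < 2" | "n = 2" | "n > 2" "even n" | m where "n = Suc (2 * m)" "m > 0"
    by (cases "even n") (fastforce elim!: oddE)+
  then show ?case
  proof cases
    case 1
    then have "{p::nat. prime p \<and> p \<le> n} = {}"
      by (auto dest: prime_ge_2_nat)
    then show ?thesis by (simp only:) simp
  next
    case 2
    then have "{p::nat. prime p \<and> p \<le> n} = {2}"
      by (auto dest: prime_ge_2_nat)
    then show ?thesis using 2 by (simp only:) simp
  next
    case 3
    then have "\<not> prime n" using prime_odd_nat by blast
    then have "p \<le> n \<longleftrightarrow> p \<le> n - 1" if "prime p" for p
      using that by (cases "p = n") auto
    then have "{p. prime p \<and> p \<le> n} = {p. prime p \<and> p \<le> n - 1}"
      by blast
    moreover have "\<Prod>{p::nat. prime p \<and> p \<le> n - 1} \<le> 4 ^ (n - 1)"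
      using 3 by (intro less) auto
    moreover have "(4::nat) ^ (n - 1) \<le> 4 ^ n"
      by (intro power_increasing) auto
    ultimately show ?thesis by (simp only: order_trans)
  next
    case (4 m)
    let ?A = "{p::nat. prime p \<and> p \<le> Suc m}" and ?B = "{p. prime p \<and> Suc m < p \<and> p \<le> n}"
    have "{p. prime p \<and> p \<le> n} = ?A \<union> ?B"
      using 4 by auto
    then have "\<Prod>{p. prime p \<and> p \<le> n} = \<Prod>?A * \<Prod>?B"
      by (simp only:) (subst prod.union_disjoint, auto)
    also have "\<Prod>?A \<le> 4 ^ Suc m"
      using 4 by (intro less) auto
    also have "\<Prod>?B \<le> n choose m"
      using 4 by (intro dvd_imp_le prod_primes_dvd)
        (auto intro!: prime_dvd_binomial)
    also have "n choose m \<le> 4 ^ m"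
      using 4 binomial_odd_le_four_power by simp
    finally show ?thesis
      using 4 by (simp add: power_add mult_2)
  qed
qed

section \<open>Upper bound for the lcm by the size of its primes\<close>

lemma Lcm_upto_le:
  fixes n N :: nat
  assumes "N > 0"
  shows "Lcm {1..N} \<le> N ^ floor_sqrt N * 4 ^ n * N ^ card {p. prime p \<and> n < p \<and> p \<le> N}"
proof -
  define L where "L = Lcm {1..N}"
  define P where "P = {p. prime p \<and> p \<le> N}"
  have fin: "finite P" by (simp add: P_def)
  have "L \<noteq> 0" by (simp add: L_def Lcm_0_iff)
  have sub: "prime_factors L \<subseteq> P"
  proof
    fix p assume "p \<in> prime_factors L"
    then have p: "prime p" "p dvd L" by auto
    then show "p \<in> P"
      using prime_power_dvd_Lcm[of "{1..N}" p 1] by (auto simp: L_def P_def dest: dvd_imp_le)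
  qed
  have "L = (\<Prod>p\<in>prime_factors L. p ^ multiplicity p L)"
    using prod_prime_factors[OF \<open>L \<noteq> 0\<close>] by simp
  also have "\<dots> = (\<Prod>p\<in>P. p ^ multiplicity p L)"
    using fin sub \<open>L \<noteq> 0\<close>
    by (intro prod.mono_neutral_left) (auto simp: P_def prime_factors_multiplicity)
  \<comment> \<open>The three ranges may overlap: every factor is at least 1, so charging a prime
    twice keeps the upper bound valid.\<close>
  also have "\<dots> \<le> (\<Prod>p\<in>P. (if p \<le> floor_sqrt N then N else 1) * (if p \<le> n then p else 1) *
      (if n < p then N else 1))"
  proof (intro prod_mono conjI)
    fix p assume "p \<in> P"
    then have p: "prime p" and "p \<le> N" "p > 0"
      by (auto simp: P_def prime_gt_0_nat)
    have le: "p ^ multiplicity p L \<le> N"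
      unfolding L_def using p assms by (rule prime_power_multiplicity_Lcm_le)
    have "p ^ multiplicity p L \<le> p" if "\<not> p \<le> floor_sqrt N"
    proof -
      have "N < p ^ 2" using that by (simp add: le_floor_sqrt_iff)
      with le have "p ^ multiplicity p L < p ^ 2" by simp
      then have "multiplicity p L < 2"
        by (rule power_less_imp_less_exp[OF prime_gt_1_nat[OF p]])
      then show ?thesis
        using power_increasing[of "multiplicity p L" 1 p] \<open>p > 0\<close> by simp
    qed
    moreover have "N \<le> N * p" "N \<le> N * N" using assms \<open>p > 0\<close> by simp_all
    ultimately show "p ^ multiplicity p L \<le> (if p \<le> floor_sqrt N then N else 1) *
        (if p \<le> n then p else 1) * (if n < p then N else 1)"
      using le by (auto intro: order_trans)
  qed simp
  also have "\<dots> = N ^ card {p\<in>P. p \<le> floor_sqrt N} * \<Prod>{p\<in>P. p \<le> n} * N ^ card {p\<in>P. n < p}"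
    using fin by (simp add: prod.distrib flip: prod.inter_filter)
  also have "N ^ card {p\<in>P. p \<le> floor_sqrt N} \<le> N ^ floor_sqrt N"
  proof (intro power_increasing)
    have "card {p\<in>P. p \<le> floor_sqrt N} \<le> card {1..floor_sqrt N}"
      by (intro card_mono) (auto simp: P_def dest: prime_gt_0_nat)
    then show "card {p\<in>P. p \<le> floor_sqrt N} \<le> floor_sqrt N" by simp
  qed (use assms in simp)
  also have "\<Prod>{p\<in>P. p \<le> n} \<le> \<Prod>{p. prime p \<and> p \<le> n}"
    by (intro dvd_imp_le prod_dvd_prod_subset prod_pos) (auto simp: P_def prime_gt_0_nat)
  also have "\<dots> \<le> 4 ^ n"
    by (rule prod_primes_le_four_power)
  also have "{p\<in>P. n < p} = {p. prime p \<and> n < p \<and> p \<le> N}"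
    by (auto simp: P_def)
  finally show ?thesis by (simp add: L_def)
qed

section \<open>Numerical comparison for large \<open>n\<close>\<close>

lemma power8_le_two_power:
  fixes q :: nat
  assumes "q \<ge> 44"
  shows "q ^ 8 \<le> 2 ^ q"
  using assms
proof (induction q rule: dec_induct)
  case (step q)
  \<comment> \<open>One step multiplies the left side by at most (45/44)^8 < 2.\<close>
  have "44 * Suc q \<le> 45 * q" using step by simp
  then have "(44 * Suc q) ^ 8 \<le> (45 * q) ^ 8" by (rule power_mono) simp
  then have "44 ^ 8 * Suc q ^ 8 \<le> 45 ^ 8 * q ^ 8" by (simp only: power_mult_distrib)
  also have "\<dots> \<le> 44 ^ 8 * (2 * q ^ 8)" by simp
  finally have "Suc q ^ 8 \<le> 2 * q ^ 8"
    by (subst (asm) mult_le_cancel1) simp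
  with step.IH show ?case by simp
qed simp

lemma power_floor_sqrt_less:
  fixes n :: nat
  assumes "n \<ge> 256"
  shows "(8 * n + 1) ^ (17 + floor_sqrt (8 * n + 1)) < 64 ^ n"
proof -
  define N where "N = 8 * n + 1"
  define q where "q = Suc (floor_sqrt N)"
  have "45 \<le> floor_sqrt N"
    using assms by (simp add: le_floor_sqrt_iff N_def)
  then have q: "q \<ge> 46" by (simp add: q_def)
  have Nq: "N < q ^ 2" unfolding q_def by (rule Suc_floor_sqrt_power2_gt)
  \<comment> \<open>The fourth power turns \<open>q ^ 2\<close> into \<open>q ^ 8\<close>, which
    \<open>power8_le_two_power\<close> bounds. The exponent \<open>16 + q\<close> is
    \<open>17 + floor_sqrt N\<close>.\<close>
  have "(N ^ (16 + q)) ^ 4 \<le> ((q ^ 2) ^ (16 + q)) ^ 4"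
    using Nq by (intro power_mono) auto
  also have "\<dots> = (q ^ 8) ^ (16 + q)"
    by (simp flip: power_mult add: mult_ac)
  also have "\<dots> \<le> (2 ^ q) ^ (16 + q)"
    using q by (intro power_mono power8_le_two_power) auto
  also have "\<dots> = 2 ^ (q * (16 + q))"
    by (simp add: power_mult)
  also have "\<dots> < 2 ^ (24 * n)"
  proof (intro power_strict_increasing)
    \<comment> \<open>Since (q - 1)^2 \<le> 8n + 1, 24n is at least 3(q - 1)^2 - 3; writing
      \<open>q = s + 46\<close> leaves an inequality between polynomials in \<open>s\<close> that
      holds coefficientwise.\<close>
    obtain s where s: "q = s + 46" using q by (metis add.commute le_Suc_ex)
    have "(s + 45) ^ 2 \<le> N"
      using s by (simp add: q_def flip: le_floor_sqrt_iff)
    then show "q * (16 + q) < 24 * n"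
      by (simp add: s N_def power2_eq_square algebra_simps)
  qed simp
  also have "(2::nat) ^ (24 * n) = ((2 ^ 6) ^ n) ^ 4"
    unfolding power_mult[symmetric] by simp
  also have "\<dots> = (64 ^ n) ^ 4" by simp
  finally have "N ^ (16 + q) < 64 ^ n"
    by (rule power_less_imp_less_base) simp
  then show ?thesis by (simp add: N_def q_def)
qed

lemma card_primes_ge_18_large:
  fixes n :: nat
  assumes "n \<ge> 256"
  shows "card {p. prime p \<and> n < p \<and> p \<le> 8 * n + 1} \<ge> 18"
proof (rule ccontr)
  define N where "N = 8 * n + 1"
  assume "\<not> ?thesis"
  then have "card {p. prime p \<and> n < p \<and> p \<le> N} \<le> 17" by (simp add: N_def)
  then have "N ^ card {p. prime p \<and> n < p \<and> p \<le> N} \<le> N ^ 17"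
    by (intro power_increasing) (auto simp: N_def)
  then have "N ^ floor_sqrt N * 4 ^ n * N ^ card {p. prime p \<and> n < p \<and> p \<le> N} \<le>
      N ^ floor_sqrt N * 4 ^ n * N ^ 17"
    by (rule mult_left_mono) simp
  also have "\<dots> = 4 ^ n * N ^ (17 + floor_sqrt N)"
    by (simp add: power_add)
  also have "\<dots> < 4 ^ n * 64 ^ n"
    using power_floor_sqrt_less[OF assms] by (simp add: N_def)
  also have "\<dots> = (4 * 64) ^ n" by (simp only: power_mult_distrib)
  also have "\<dots> = 4 ^ (4 * n)" by (simp add: power_mult)
  also have "\<dots> \<le> Lcm {1..N}"
    using four_power_le_Lcm[of "4 * n"] by (simp add: N_def)
  finally show False
    using Lcm_upto_le[of N n] by (simp add: N_def)
qed

section \<open>Explicit lists of primes for small \<open>n\<close>\<close>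

lemma prime_natI_less_power2:
  fixes p r :: nat
  assumes "1 < p" "p < r ^ 2" "\<forall>d\<in>set [2..<r]. \<not> d dvd p"
  shows "prime p"
  unfolding prime_nat_iff
proof (intro conjI allI impI)
  have small: "d = 1 \<or> r \<le> d" if "d dvd p" for d
    using that assms by (cases "d = 0"; cases "d < r") (auto simp: Suc_le_eq)
  fix d assume "d dvd p"
  then obtain e where e: "p = d * e" ..
  \<comment> \<open>Two cofactors both at least \<open>r\<close> would have product at least
    \<open>r ^ 2 > p\<close>, so one of them is 1.\<close>
  have "\<not> (r \<le> d \<and> r \<le> e)"
    using assms(2) e mult_le_mono[of r d r e] by (auto simp: power2_eq_square)
  then show "d = 1 \<or> d = p"
    using small[of d] small[of e] e by auto
qed (fact assms(1))

lemma length_le_card_primes_between: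
  fixes a b :: nat
  assumes "sorted_wrt (<) xs" "\<forall>p\<in>set xs. prime p \<and> a < p \<and> p < b"
  shows "length xs \<le> card {p. prime p \<and> a < p \<and> p < b}"
proof -
  have "length xs = card (set xs)"
    using assms(1) by (simp add: distinct_card strict_sorted_iff)
  also have "\<dots> \<le> card {p. prime p \<and> a < p \<and> p < b}"
    using assms(2) by (intro card_mono) auto
  finally show ?thesis .
qed

theorem theorem3p2p2:
  fixes n :: nat
  assumes "n > 8"
  shows "card {p :: nat. prime p \<and> n < p \<and> p < 9 * n} \<ge> 18"
proof -
  let ?C = "card {p :: nat. prime p \<and> n < p \<and> p < 9 * n}"
  \<comment> \<open>A list serves every \<open>n\<close> below its first prime for which
    \<open>9 * n\<close> exceeds its last. Trial division below 19 suffices for the last two lists,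
    as 359 < 19^2.\<close>
  consider "n \<le> 10" | "11 \<le> n" "n \<le> 18" | "19 \<le> n" "n \<le> 78" | "79 \<le> n" "n < 256" | "n \<ge> 256"
    using assms by linarith
  then show ?thesis
  proof cases
    case 1
    then have "length [11::nat, 13, 17, 19, 23, 29, 31, 37, 41, 43, 47, 53, 59, 61, 67, 71, 73, 79] \<le> ?C"
      using assms by (intro length_le_card_primes_between) simp_all
    then show ?thesis by simp
  next
    case 2
    then have "length [19::nat, 23, 29, 31, 37, 41, 43, 47, 53, 59, 61, 67, 71, 73, 79, 83, 89, 97] \<le> ?C"
      by (intro length_le_card_primes_between) simp_all
    then show ?thesis by simp
  next
    case 3
    then have "length [79::nat, 83, 89, 97, 101, 103, 107, 109, 113, 127, 131, 137, 139, 149, 151,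
        157, 163, 167] \<le> ?C"
      by (intro length_le_card_primes_between)
        (simp_all add: prime_natI_less_power2[of _ 19] del: prime_nat_numeral_eq)
    then show ?thesis by simp
  next
    case 4
    then have "length [257::nat, 263, 269, 271, 277, 281, 283, 293, 307, 311, 313, 317, 331, 337,
        347, 349, 353, 359] \<le> ?C"
      by (intro length_le_card_primes_between)
        (simp_all add: prime_natI_less_power2[of _ 19] del: prime_nat_numeral_eq)
    then show ?thesis by simp
  next
    case 5
    have "18 \<le> card {p. prime p \<and> n < p \<and> p \<le> 8 * n + 1}"
      using 5 by (rule card_primes_ge_18_large)
    also have "\<dots> \<le> ?C"
      using 5 by (intro card_mono) auto
    finally show ?thesis .
  qed
qed

end
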